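(* Let $p>1$, $a\le 0$, $R\ge 1$, and let $(f,g)\in C_0^2(\mathbb{R})\times C_0^1(\mathbb{R})$ satisfy $\operatorname{supp} f,\ \operatorname{supp} g\subset\{x\in\mathbb{R}:|x|\le R\}$ and $$\int_{\mathbb{R}}g(x)\,dx>0.$$ Then there exist a constant $\varepsilon_2=\varepsilon_2(g,p,a,R)>0$ and a constant $C>0$ independent of $\varepsilon$ such that, for every $\varepsilon$ with $0<\varepsilon\le\varepsilon_2$ and every $T>0$ satisfying $$T\ge C\varepsilon^{-(p-1)/(-a)}\ \text{ if } a<0,\qquad T\ge\exp\left(C\varepsilon^{-(p-1)}\right)\ \text{ if } a=0,$$ there is no function $U\in C(\mathbb{R}\times[0,T])$ with $\operatorname{supp} U\subset\{(x,t)\in\mathbb{R}\times[0,T]:|x|\le t+R\}$ satisfying the integral equation $$U(x,t)=\varepsilon u_t^0(x,t)+L_a'(|U|^p)(x,t)\quad\text{for all }(x,t)\in\mathbb{R}\times[0,T].$$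
   Context: The function $u_t^0$ is the time derivative of the solution of the free wave equation with data $(f,g)$: $$u_t^0(x,t)=\frac12\{f'(x+t)-f'(x-t)+g(x+t)+g(x-t)\}.$$ For a continuous function $v=v(x,t)$ the linear operator $L_a'$ is defined by $$L_a'(v)(x,t):=\frac12\int_0^t\frac{v(x+t-s,s)}{\{1+(x+t-s)^2\}^{(1+a)/2}}\,ds+\frac12\int_0^t\frac{v(x-t+s,s)}{\{1+(x-t+s)^2\}^{(1+a)/2}}\,ds.$$ The integral equation is the one satisfied by $U=u_t$ when $u$ is a classical solution of $u_{tt}-u_{xx}=|u_t|^p/(1+x^2)^{(1+a)/2}$ with $u(x,0)=\varepsilon f(x)$, $u_t(x,0)=\varepsilon g(x)$. $C_0^k(\mathbb{R})$ denotes the compactly supported $C^k$ functions on $\mathbb{R}$. *)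

theory Defs
  imports "HOL-Analysis.Analysis"
begin

text \<open>The closure is taken in the ambient space \<^term>\<open>UNIV\<close>. For a function considered on a closed
  set \<^term>\<open>S\<close> only, this is the same as the closure relative to \<^term>\<open>S\<close>; the values outside
  \<^term>\<open>S\<close> play no role.\<close>

definition supp_on :: "'a::topological_space set \<Rightarrow> ('a \<Rightarrow> real) \<Rightarrow> 'a set" where
  "supp_on S f = closure (support_on S f)"

definition C_k :: "nat \<Rightarrow> (real \<Rightarrow> real) set" where
  "C_k k = {f. (\<forall>j<k. \<forall>x. (deriv ^^ j) f differentiable at x) \<and>
               continuous_on UNIV ((deriv ^^ k) f)}"

definition C0_k :: "nat \<Rightarrow> (real \<Rightarrow> real) set" where
  "C0_k k = {f \<in> C_k k. compact (supp_on UNIV f)}"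

definition u0_t :: "(real \<Rightarrow> real) \<Rightarrow> (real \<Rightarrow> real) \<Rightarrow> real \<times> real \<Rightarrow> real" where
  "u0_t f g = (\<lambda>(x, t). 1/2 * (deriv f (x + t) - deriv f (x - t) + g (x + t) + g (x - t)))"

text \<open>Space-time points are pairs \<open>(x, t)\<close>. The integrals over \<open>{0..t}\<close> are meant for
  \<open>t \<ge> 0\<close> (for negative \<open>t\<close> they are 0 rather than oriented integrals).\<close>

definition L' :: "real \<Rightarrow> (real \<times> real \<Rightarrow> real) \<Rightarrow> real \<times> real \<Rightarrow> real" where
  "L' a v = (\<lambda>(x, t).
     1/2 * integral {0..t} (\<lambda>s. v (x + t - s, s) / (1 + (x + t - s)\<^sup>2) powr ((1 + a) / 2)) +
     1/2 * integral {0..t} (\<lambda>s. v (x - t + s, s) / (1 + (x - t + s)\<^sup>2) powr ((1 + a) / 2)))"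

end

theory Submission
  imports Defs
begin

text \<open>
  The idea is to watch \<open>U\<close> along a single outgoing characteristic \<open>x - t = \<xi>\<close>. The total
  integral of \<open>g - f'\<close> equals that of \<open>g\<close>, because \<open>f\<close> has compact support, so it is positive
  and some \<open>\<xi>\<close> satisfies \<open>g \<xi> - f' \<xi> > 0\<close> (lemma \<open>exists_positive_outgoing_profile\<close>).
  Once \<open>t > R\<close> the incoming half of the free wave has passed, so on this characteristic the free
  wave is the constant \<open>A = \<epsilon> (g \<xi> - f' \<xi>) / 2\<close>. Of the two integrals in \<open>L'\<close>, the second one
  runs along the very same characteristic and the first one is nonnegative. Hence
  \<open>V t = U (\<xi> + t, t)\<close> satisfies the closed inequality
  \<open>V t \<ge> A + 1/2 \<integral> w s * \<bar>V s\<bar>\<^sup>p ds\<close>, where \<open>w s\<close> is comparable to \<open>s\<close> to the power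
  \<open>-1 - a\<close> (lemma \<open>weight_on_characteristic_lower_bound\<close>).

  Comparing with the differential equation \<open>y' = 1/2 w y\<^sup>p\<close>, \<open>y = A\<close> initially, shows that such
  a \<open>V\<close> cannot exist on an interval on which the integral of \<open>w\<close> exceeds a multiple of
  \<open>A\<close> to the power \<open>1 - p\<close> (lemma \<open>superlinear_integral_inequality_bound\<close>). That integral grows
  like \<open>T\<close> to the power \<open>-a\<close> when \<open>a < 0\<close> and like \<open>ln T\<close> when \<open>a = 0\<close>, which gives the two
  lifespan bounds. The function \<open>f\<close> influences only \<open>\<xi>\<close> and \<open>A / \<epsilon>\<close>, hence \<open>C\<close>; the bound on
  \<open>\<epsilon>\<close> serves to absorb additive constants into \<open>C\<close>, so \<open>\<epsilon>\<^sub>2 = 1\<close> works.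
\<close>

section \<open>A nonlinear integral inequality\<close>

text \<open>
  The right-hand side \<open>F\<close> of the inequality satisfies \<open>F' = w \<bar>V\<bar>\<^sup>p \<ge> w F\<^sup>p\<close>, as \<open>V \<ge> F > 0\<close>.
  So \<open>F\<close> to the power \<open>1 - p\<close>, a positive quantity, decreases at least at the rate \<open>(p - 1) w\<close>.
\<close>

lemma superlinear_integral_inequality_bound:
  fixes p A t\<^sub>1 T :: real and V w H h :: "real \<Rightarrow> real"
  assumes p: "p > 1" and A: "A > 0" and T: "t\<^sub>1 \<le> T"
    and V: "continuous_on {t\<^sub>1..T} V" and w: "continuous_on {t\<^sub>1..T} w"
    and H: "\<And>s. s \<in> {t\<^sub>1..T} \<Longrightarrow> (H has_real_derivative h s) (at s)"
    and hw: "\<And>s. s \<in> {t\<^sub>1..T} \<Longrightarrow> h s \<le> w s"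
    and w0: "\<And>s. s \<in> {t\<^sub>1..T} \<Longrightarrow> 0 \<le> w s"
    and ineq: "\<And>t. t \<in> {t\<^sub>1..T} \<Longrightarrow> V t \<ge> A + integral {t\<^sub>1..t} (\<lambda>s. w s * \<bar>V s\<bar> powr p)"
  shows "(p - 1) * (H T - H t\<^sub>1) < A powr (1 - p)"
proof -
  define F where "F t = A + integral {t\<^sub>1..t} (\<lambda>s. w s * \<bar>V s\<bar> powr p)" for t
  have cont: "continuous_on {t\<^sub>1..T} (\<lambda>s. w s * \<bar>V s\<bar> powr p)"
    using p by (intro continuous_intros w V continuous_on_powr') auto
  have F': "(F has_real_derivative w s * \<bar>V s\<bar> powr p) (at s within {t\<^sub>1..T})"
    if "s \<in> {t\<^sub>1..T}" for s
    unfolding F_def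
    by (rule derivative_eq_intros refl integral_has_real_derivative cont that)+ simp
  have FA: "F s \<ge> A" if "s \<in> {t\<^sub>1..T}" for s
  proof -
    have "(\<lambda>s. w s * \<bar>V s\<bar> powr p) integrable_on {t\<^sub>1..s}"
      using that by (intro integrable_continuous_real continuous_on_subset[OF cont]) auto
    moreover have "\<And>r. r \<in> {t\<^sub>1..s} \<Longrightarrow> 0 \<le> w r * \<bar>V r\<bar> powr p"
      using that w0 by auto
    ultimately have "0 \<le> integral {t\<^sub>1..s} (\<lambda>s. w s * \<bar>V s\<bar> powr p)"
      by (intro Henstock_Kurzweil_Integration.integral_nonneg) auto
    then show ?thesis by (simp add: F_def)
  qed
  define \<Phi> where "\<Phi> t = F t powr (1 - p) + (p - 1) * H t" for t
  have \<Phi>': "(\<Phi> has_real_derivative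
      (1 - p) * F s powr (- p) * (w s * \<bar>V s\<bar> powr p) + (p - 1) * h s) (at s within {t\<^sub>1..T})"
    if s: "s \<in> {t\<^sub>1..T}" for s
  proof -
    have pos: "F s > 0" using FA[OF s] A by simp
    have "((\<lambda>x. F x powr (1 - p)) has_real_derivative
        (1 - p) * F s powr (1 - p - 1) * (w s * \<bar>V s\<bar> powr p)) (at s within {t\<^sub>1..T})"
      by (rule DERIV_chain2[OF has_real_derivative_powr[OF pos] F'[OF s]])
    moreover have "((\<lambda>x. (p - 1) * H x) has_real_derivative (p - 1) * h s) (at s within {t\<^sub>1..T})"
      by (intro DERIV_cmult has_field_derivative_at_within[OF H[OF s]])
    ultimately show ?thesis
      unfolding \<Phi>_def by (auto dest: DERIV_add)
  qed
  have nonpos: "(1 - p) * F s powr (- p) * (w s * \<bar>V s\<bar> powr p) + (p - 1) * h s \<le> 0"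
    if s: "s \<in> {t\<^sub>1..T}" for s
  proof -
    have pos: "F s > 0" using FA[OF s] A by simp
    have "F s \<le> V s" using ineq[OF s] by (simp add: F_def)
    then have "F s powr p \<le> \<bar>V s\<bar> powr p"
      using pos p by (intro powr_mono2) auto
    then have "F s powr (- p) * F s powr p \<le> F s powr (- p) * \<bar>V s\<bar> powr p"
      by (intro mult_left_mono) auto
    then have "1 \<le> F s powr (- p) * \<bar>V s\<bar> powr p"
      using pos by (simp flip: powr_add)
    then have "w s * 1 \<le> w s * (F s powr (- p) * \<bar>V s\<bar> powr p)"
      using w0[OF s] by (intro mult_left_mono) auto
    then have "h s \<le> w s * (F s powr (- p) * \<bar>V s\<bar> powr p)"
      using hw[OF s] by simp
    then have "(p - 1) * h s \<le> (p - 1) * (w s * (F s powr (- p) * \<bar>V s\<bar> powr p))"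
      using p by (intro mult_left_mono) auto
    then show ?thesis by (simp add: algebra_simps)
  qed
  have "\<Phi> T \<le> \<Phi> t\<^sub>1"
  proof (rule DERIV_nonpos_imp_decreasing_open[OF T])
    show "continuous_on {t\<^sub>1..T} \<Phi>"
      using \<Phi>' by (rule DERIV_continuous_on)
    fix s assume "t\<^sub>1 < s" "s < T"
    then show "\<exists>y. (\<Phi> has_real_derivative y) (at s) \<and> y \<le> 0"
      using \<Phi>'[of s] nonpos[of s] by (auto simp: at_within_Icc_at)
  qed
  moreover have "F T powr (1 - p) > 0"
    using FA[of T] A T by auto
  moreover have "F t\<^sub>1 powr (1 - p) = A powr (1 - p)" by (simp add: F_def)
  ultimately show ?thesis
    unfolding \<Phi>_def right_diff_distrib by linarith
qed

section \<open>The weight along an outgoing characteristic\<close>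

text \<open>
  From \<open>s = R + 1\<close> on, the position \<open>\<xi> + s\<close> on a characteristic issuing from \<open>[-R, R]\<close> lies
  between two fixed multiples of \<open>s\<close>. Which of them matters depends on the sign of \<open>1 + a\<close>.
\<close>

lemma weight_on_characteristic_lower_bound:
  fixes a R \<xi> :: real
  assumes R: "R \<ge> 1" and \<xi>: "\<bar>\<xi>\<bar> \<le> R"
  shows "\<exists>\<kappa>>0. \<forall>s\<ge>R+1. \<kappa> * s powr (- 1 - a) \<le> 1 / (1 + (\<xi> + s)\<^sup>2) powr ((1 + a) / 2)"
proof -
  define q where "q = (1 + a) / 2"
  have scale: "(b * s\<^sup>2) powr (- q) = b powr (- q) * s powr (- 1 - a)"
    if "s \<ge> R + 1" "b > 0" for s b :: real
  proof -
    have "(s\<^sup>2) powr (- q) = s powr (- 1 - a)"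
      using that R by (simp add: powr_powr q_def flip: powr_numeral) (simp add: add_divide_distrib)
    then show ?thesis using that by (simp add: powr_mult)
  qed
  have inv: "1 / y powr ((1 + a) / 2) = y powr (- q)" for y :: real
    by (simp add: q_def powr_minus_divide)
  show ?thesis
  proof (cases "q \<ge> 0")
    case True
    have "5 powr (- q) * s powr (- 1 - a) \<le> (1 + (\<xi> + s)\<^sup>2) powr (- q)" if s: "s \<ge> R + 1" for s
    proof -
      have "(\<xi> + s)\<^sup>2 \<le> (2 * s)\<^sup>2" using s \<xi> R by (intro power_mono) auto
      moreover have "1 \<le> s\<^sup>2" using s R by (simp add: one_le_power)
      ultimately have "1 + (\<xi> + s)\<^sup>2 \<le> 5 * s\<^sup>2" by (simp add: power_mult_distrib)
      then have "(5 * s\<^sup>2) powr (- q) \<le> (1 + (\<xi> + s)\<^sup>2) powr (- q)"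
        using True by (intro powr_mono2') (auto intro: add_pos_nonneg)
      then show ?thesis using scale[OF s, of 5] by simp
    qed
    then show ?thesis unfolding inv by (intro exI[of _ "5 powr (- q)"]) auto
  next
    case False
    define \<delta> where "\<delta> = (1 / (R + 1))\<^sup>2"
    have \<delta>: "\<delta> > 0" using R by (simp add: \<delta>_def)
    have "\<delta> powr (- q) * s powr (- 1 - a) \<le> (1 + (\<xi> + s)\<^sup>2) powr (- q)" if s: "s \<ge> R + 1" for s
    proof -
      have "0 \<le> R * (s - (R + 1))" using s R by simp
      then have "1 / (R + 1) * s \<le> s - R"
        using R by (simp add: field_simps)
      also have "\<dots> \<le> \<xi> + s" using \<xi> by simp
      finally have "(1 / (R + 1) * s)\<^sup>2 \<le> (\<xi> + s)\<^sup>2"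
        using s R by (intro power_mono) auto
      then have "\<delta> * s\<^sup>2 \<le> 1 + (\<xi> + s)\<^sup>2" by (simp add: \<delta>_def power_mult_distrib power_divide)
      then have "(\<delta> * s\<^sup>2) powr (- q) \<le> (1 + (\<xi> + s)\<^sup>2) powr (- q)"
        using False \<delta> by (intro powr_mono2) auto
      then show ?thesis using scale[OF s \<delta>] by simp
    qed
    then show ?thesis unfolding inv using \<delta> by (intro exI[of _ "\<delta> powr (- q)"]) auto
  qed
qed

section \<open>The data\<close>

lemma zero_outside_supp_on:
  fixes f :: "real \<Rightarrow> real"
  assumes "supp_on UNIV f \<subseteq> {x. \<bar>x\<bar> \<le> R}" and "\<bar>x\<bar> > R"
  shows "f x = 0"
proof (rule ccontr)
  assume "f x \<noteq> 0"
  then have "x \<in> supp_on UNIV f"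
    unfolding supp_on_def support_on_def by (intro subsetD[OF closure_subset]) auto
  then show False using assms by auto
qed

lemma deriv_zero_outside_supp_on:
  assumes "supp_on UNIV f \<subseteq> {x. \<bar>x\<bar> \<le> R}" and x: "\<bar>x\<bar> > R"
  shows "deriv f x = 0"
proof -
  have "open {y::real. \<bar>y\<bar> > R}" by (intro open_Collect_less continuous_intros)
  then have "(f has_real_derivative 0) (at x)"
    by (rule has_field_derivative_transform_within_open[rotated])
       (use x zero_outside_supp_on[OF assms(1)] in auto)
  then show ?thesis by (rule DERIV_imp_deriv)
qed

lemma C_k_Suc_differentiable: "f \<in> C_k (Suc k) \<Longrightarrow> f differentiable at x"
  by (fastforce simp: C_k_def dest: spec[of _ 0])

lemma C_k_1_continuous_on: "f \<in> C_k 1 \<Longrightarrow> continuous_on S f"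
  using C_k_Suc_differentiable[of f 0]
  by (auto intro!: continuous_at_imp_continuous_on differentiable_imp_continuous_within)

lemma C_k_2_continuous_on_deriv: "f \<in> C_k 2 \<Longrightarrow> continuous_on S (deriv f)"
  by (fastforce simp: C_k_def dest: spec[of _ "Suc 0"]
      intro: continuous_at_imp_continuous_on differentiable_imp_continuous_within)

text \<open>
  If \<open>g \<le> f'\<close> everywhere, then integrating over an interval that contains both supports would
  give \<open>\<integral> g \<le> 0\<close>.
\<close>

lemma exists_positive_outgoing_profile:
  fixes f g :: "real \<Rightarrow> real"
  assumes f: "f \<in> C_k 2" and g: "g \<in> C_k 1" and R: "R \<ge> 0"
    and sf: "supp_on UNIV f \<subseteq> {x. \<bar>x\<bar> \<le> R}" and sg: "supp_on UNIV g \<subseteq> {x. \<bar>x\<bar> \<le> R}"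
    and pos: "integral UNIV g > 0"
  shows "\<exists>\<xi>. \<bar>\<xi>\<bar> \<le> R \<and> g \<xi> - deriv f \<xi> > 0"
proof (rule ccontr)
  assume neg: "\<not> ?thesis"
  define S where "S = R + 1"
  have le: "g x \<le> deriv f x" for x
    using neg zero_outside_supp_on[OF sg, of x] deriv_zero_outside_supp_on[OF sf, of x]
    by (cases "\<bar>x\<bar> \<le> R") force+
  have "(f has_real_derivative deriv f x) (at x)" for x
    using C_k_Suc_differentiable[of f 1] f
    by (simp add: DERIV_deriv_iff_real_differentiable numeral_2_eq_2)
  then have "(deriv f has_integral f S - f (- S)) {- S..S}"
    using R by (intro fundamental_theorem_of_calculus)
      (auto simp: S_def has_real_derivative_iff_has_vector_derivative[symmetric]
        intro: has_field_derivative_at_within)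
  moreover have "f S = 0" "f (- S) = 0"
    using R by (auto simp: S_def intro!: zero_outside_supp_on[OF sf])
  ultimately have f0: "(deriv f has_integral 0) {- S..S}" by simp
  have gS: "(g has_integral integral {- S..S} g) {- S..S}"
    using g by (intro integrable_integral integrable_continuous_real C_k_1_continuous_on)
  then have "(g has_integral integral {- S..S} g) UNIV"
    by (rule has_integral_on_superset) (auto simp: S_def intro!: zero_outside_supp_on[OF sg])
  then have "integral UNIV g = integral {- S..S} g"
    by (rule integral_unique)
  with gS have "integral UNIV g \<le> 0"
    using has_integral_le[OF _ f0] le by metis
  with pos show False by simp
qed

section \<open>Nonexistence on long time intervals\<close>

text \<open>
  The inequality closes on one characteristic because the outgoing integral in \<open>L'\<close> sees no other
  values of \<open>U\<close>, while the incoming integral, which does, has a nonnegative integrand. The part of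
  the outgoing integral before time \<open>R + 1\<close> is dropped for the same reason.
\<close>

lemma integral_inequality_on_characteristic:
  fixes U :: "real \<times> real \<Rightarrow> real"
  assumes R: "R \<ge> 1" and p: "p > 1" and \<xi>: "\<bar>\<xi>\<bar> \<le> R"
    and sf: "supp_on UNIV f \<subseteq> {x. \<bar>x\<bar> \<le> R}" and sg: "supp_on UNIV g \<subseteq> {x. \<bar>x\<bar> \<le> R}"
    and U: "continuous_on (UNIV \<times> {0..T}) U"
    and eq: "\<And>x t. t \<in> {0..T} \<Longrightarrow>
      U (x, t) = \<epsilon> * u0_t f g (x, t) + L' a (\<lambda>z. \<bar>U z\<bar> powr p) (x, t)"
    and t: "t \<in> {R+1..T}"
  shows "U (\<xi> + t, t) \<ge> \<epsilon> * ((g \<xi> - deriv f \<xi>) / 2) + integral {R+1..t}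
    (\<lambda>s. 1/2 * (1 / (1 + (\<xi> + s)\<^sup>2) powr ((1 + a) / 2)) * \<bar>U (\<xi> + s, s)\<bar> powr p)"
proof -
  let ?wt = "\<lambda>x::real. (1 + x\<^sup>2) powr ((1 + a) / 2)"
  let ?in = "\<lambda>s. \<bar>U (\<xi> + t + t - s, s)\<bar> powr p / ?wt (\<xi> + t + t - s)"
  let ?out = "\<lambda>s. \<bar>U (\<xi> + s, s)\<bar> powr p / ?wt (\<xi> + s)"
  have one: "1 + x\<^sup>2 > 0" for x :: real by (simp add: add_pos_nonneg)
  have integrable_wave: "(\<lambda>s. \<bar>U (X s, s)\<bar> powr p / ?wt (X s)) integrable_on {b..t}"
    if X: "continuous_on UNIV X" and b: "b \<ge> 0" for X :: "real \<Rightarrow> real" and b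
  proof (rule integrable_continuous_real)
    have X': "continuous_on {b..t} X" by (rule continuous_on_subset[OF X]) auto
    have "continuous_on {b..t} (\<lambda>s. U (X s, s))"
      by (rule continuous_on_compose2[OF U]) (use X' b t in \<open>auto intro!: continuous_intros\<close>)
    then show "continuous_on {b..t} (\<lambda>s. \<bar>U (X s, s)\<bar> powr p / ?wt (X s))"
      using p one by (intro continuous_intros X' continuous_on_powr')
        (auto simp: less_imp_neq[OF one, symmetric])
  qed
  have out_int: "?out integrable_on {b..t}" if "b \<ge> 0" for b
    by (rule integrable_wave) (use that in \<open>auto intro!: continuous_intros\<close>)
  have "?in integrable_on {0..t}"
    by (rule integrable_wave) (auto intro!: continuous_intros)
  then have in_nonneg: "integral {0..t} ?in \<ge> 0"
    by (intro Henstock_Kurzweil_Integration.integral_nonneg) auto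
  have out_mono: "integral {R+1..t} ?out \<le> integral {0..t} ?out"
    using R by (intro integral_subset_le out_int) auto
  have out_half: "integral {R+1..t} (\<lambda>s. 1/2 * (1 / ?wt (\<xi> + s)) * \<bar>U (\<xi> + s, s)\<bar> powr p)
      = 1/2 * integral {R+1..t} ?out"
    by (simp add: field_simps flip: integral_mult_right)
  have free: "u0_t f g (\<xi> + t, t) = (g \<xi> - deriv f \<xi>) / 2"
  proof -
    \<comment> \<open>the incoming characteristic through this point starts outside the support of the data\<close>
    have "\<bar>\<xi> + t + t\<bar> > R" using \<xi> t R by auto
    then have "g (\<xi> + t + t) = 0" "deriv f (\<xi> + t + t) = 0"
      using zero_outside_supp_on[OF sg] deriv_zero_outside_supp_on[OF sf] by auto
    then show ?thesis by (simp add: u0_t_def)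
  qed
  have "U (\<xi> + t, t) = \<epsilon> * u0_t f g (\<xi> + t, t)
      + (1/2 * integral {0..t} ?in + 1/2 * integral {0..t} ?out)"
    using eq[of t "\<xi> + t"] t R by (simp add: L'_def)
  with in_nonneg out_mono show ?thesis
    unfolding out_half free by linarith
qed

text \<open>
  Leaving the antiderivative \<open>G\<close> abstract treats \<open>a < 0\<close> and \<open>a = 0\<close> together. What matters for
  the lifespan is that \<open>K\<close> depends neither on \<open>\<epsilon>\<close> nor on \<open>T\<close>: the amplitude \<open>\<epsilon>\<close> enters the
  inequality only through the initial value \<open>\<epsilon> * c\<close>.
\<close>

lemma solution_bounds_antiderivative:
  fixes p a R :: real and f g G :: "real \<Rightarrow> real"
  assumes p: "p > 1" and R: "R \<ge> 1" and f: "f \<in> C_k 2" and g: "g \<in> C_k 1"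
    and sf: "supp_on UNIV f \<subseteq> {x. \<bar>x\<bar> \<le> R}" and sg: "supp_on UNIV g \<subseteq> {x. \<bar>x\<bar> \<le> R}"
    and pos: "integral UNIV g > 0"
    and G: "\<forall>s>0. (G has_real_derivative s powr (- 1 - a)) (at s)"
  shows "\<exists>K>0. \<forall>\<epsilon>>0. \<forall>T\<ge>R+1. \<forall>U. continuous_on (UNIV \<times> {0..T}) U \<longrightarrow>
    (\<forall>(x, t) \<in> UNIV \<times> {0..T}.
       U (x, t) = \<epsilon> * u0_t f g (x, t) + L' a (\<lambda>z. \<bar>U z\<bar> powr p) (x, t)) \<longrightarrow>
    G T - G (R + 1) < K * \<epsilon> powr (1 - p)"
proof -
  obtain \<xi> where \<xi>: "\<bar>\<xi>\<bar> \<le> R" and c: "g \<xi> - deriv f \<xi> > 0"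
    using exists_positive_outgoing_profile[OF f g _ sf sg pos] R by auto
  obtain \<kappa> where \<kappa>: "\<kappa> > 0" and weight:
    "\<And>s. s \<ge> R + 1 \<Longrightarrow> \<kappa> * s powr (- 1 - a) \<le> 1 / (1 + (\<xi> + s)\<^sup>2) powr ((1 + a) / 2)"
    using weight_on_characteristic_lower_bound[OF R \<xi>] by metis
  define c where "c = (g \<xi> - deriv f \<xi>) / 2"
  have c0: "c > 0" using c by (simp add: c_def)
  define K where "K = 2 * c powr (1 - p) / ((p - 1) * \<kappa>)"
  have one: "1 + x\<^sup>2 \<noteq> 0" for x :: real
    using zero_le_power2[of x] by linarith
  have "G T - G (R + 1) < K * \<epsilon> powr (1 - p)"
    if \<epsilon>: "\<epsilon> > 0" and T: "T \<ge> R + 1" and U: "continuous_on (UNIV \<times> {0..T}) U"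
      and eq: "\<forall>(x, t) \<in> UNIV \<times> {0..T}.
       U (x, t) = \<epsilon> * u0_t f g (x, t) + L' a (\<lambda>z. \<bar>U z\<bar> powr p) (x, t)"
    for \<epsilon> T and U :: "real \<times> real \<Rightarrow> real"
  proof -
    have "(p - 1) * (\<kappa> / 2 * G T - \<kappa> / 2 * G (R + 1)) < (\<epsilon> * c) powr (1 - p)"
    proof (rule superlinear_integral_inequality_bound[OF p _ T])
      show "0 < \<epsilon> * c" using \<epsilon> c0 by simp
      show "continuous_on {R+1..T} (\<lambda>t. U (\<xi> + t, t))"
        by (rule continuous_on_compose2[OF U]) (use R in \<open>auto intro!: continuous_intros\<close>)
      show "continuous_on {R+1..T} (\<lambda>s. 1/2 * (1 / (1 + (\<xi> + s)\<^sup>2) powr ((1 + a) / 2)))"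
        using one by (intro continuous_intros) auto
      fix s assume s: "s \<in> {R+1..T}"
      show "((\<lambda>s. \<kappa> / 2 * G s) has_real_derivative \<kappa> / 2 * s powr (- 1 - a)) (at s)"
        by (intro DERIV_cmult G[rule_format]) (use s R in auto)
      show "\<kappa> / 2 * s powr (- 1 - a) \<le> 1/2 * (1 / (1 + (\<xi> + s)\<^sup>2) powr ((1 + a) / 2))"
        using weight[of s] s by auto
      show "0 \<le> 1/2 * (1 / (1 + (\<xi> + s)\<^sup>2) powr ((1 + a) / 2))" by simp
      show "\<epsilon> * c + integral {R+1..s} (\<lambda>s. 1/2 * (1 / (1 + (\<xi> + s)\<^sup>2) powr ((1 + a) / 2)) *
          \<bar>U (\<xi> + s, s)\<bar> powr p) \<le> U (\<xi> + s, s)"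
        unfolding c_def
        by (rule integral_inequality_on_characteristic[OF R p \<xi> sf sg U _ s]) (use eq in auto)
    qed
    also have "(\<epsilon> * c) powr (1 - p) = \<epsilon> powr (1 - p) * c powr (1 - p)"
      using \<epsilon> c0 by (simp add: powr_mult)
    finally show ?thesis
      using p \<kappa> by (simp add: K_def field_simps)
  qed
  moreover have "K > 0" using p \<kappa> c0 by (simp add: K_def)
  ultimately show ?thesis by blast
qed

theorem theorem2p2:
  fixes p a R :: real and g :: "real \<Rightarrow> real"
  assumes "p > 1" and "a \<le> 0" and "R \<ge> 1"
    and "g \<in> C0_k 1"
    and "supp_on UNIV g \<subseteq> {x. \<bar>x\<bar> \<le> R}"
    and "integral UNIV g > 0"
  shows "\<exists>\<epsilon>\<^sub>2>0. \<forall>f \<in> C0_k 2. supp_on UNIV f \<subseteq> {x. \<bar>x\<bar> \<le> R} \<longrightarrow>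
    (\<exists>C>0. \<forall>\<epsilon> T :: real. 0 < \<epsilon> \<and> \<epsilon> \<le> \<epsilon>\<^sub>2 \<and> T > 0 \<and>
        (a < 0 \<longrightarrow> T \<ge> C * \<epsilon> powr (- (p - 1) / (- a))) \<and>
        (a = 0 \<longrightarrow> T \<ge> exp (C * \<epsilon> powr (- (p - 1)))) \<longrightarrow>
      \<not> (\<exists>U :: real \<times> real \<Rightarrow> real.
           continuous_on (UNIV \<times> {0..T}) U \<and>
           supp_on (UNIV \<times> {0..T}) U \<subseteq> {(x, t). t \<in> {0..T} \<and> \<bar>x\<bar> \<le> t + R} \<and>
           (\<forall>(x, t) \<in> UNIV \<times> {0..T}.
              U (x, t) = \<epsilon> * u0_t f g (x, t) + L' a (\<lambda>z. \<bar>U z\<bar> powr p) (x, t))))"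
    (is "\<exists>\<epsilon>\<^sub>2>0. \<forall>f \<in> C0_k 2. _ \<longrightarrow>
      (\<exists>C>0. \<forall>\<epsilon> T. 0 < \<epsilon> \<and> \<epsilon> \<le> \<epsilon>\<^sub>2 \<and> ?long C \<epsilon> T \<longrightarrow> \<not> ?sol f \<epsilon> T)")
proof (rule exI[of _ "1::real"], intro conjI ballI impI)
  fix f assume f: "f \<in> C0_k 2" and sf: "supp_on UNIV f \<subseteq> {x. \<bar>x\<bar> \<le> R}"
  define G where "G s = (if a = 0 then ln s else s powr (- a) / (- a))" for s :: real
  have G': "(G has_real_derivative s powr (- 1 - a)) (at s)" if "s > 0" for s
  proof (cases "a = 0")
    case True
    then show ?thesis
      unfolding G_def using that
      by (auto intro!: derivative_eq_intros simp: powr_minus_divide)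
  next
    case False
    then show ?thesis
      unfolding G_def using that
      by (auto intro!: derivative_eq_intros simp: minus_diff_commute)
  qed
  have "f \<in> C_k 2" "g \<in> C_k 1" using f assms(4) by (auto simp: C0_k_def)
  from solution_bounds_antiderivative[OF assms(1,3) this sf assms(5,6)] G'
  obtain K where K: "K > 0" and bound: "\<forall>\<epsilon>>0. \<forall>T\<ge>R+1. \<forall>U. continuous_on (UNIV \<times> {0..T}) U \<longrightarrow>
    (\<forall>(x, t) \<in> UNIV \<times> {0..T}.
       U (x, t) = \<epsilon> * u0_t f g (x, t) + L' a (\<lambda>z. \<bar>U z\<bar> powr p) (x, t)) \<longrightarrow>
    G T - G (R + 1) < K * \<epsilon> powr (1 - p)"
    by blast
  \<comment> \<open>\<open>C\<close> solves \<open>G C = G (R + 1) + K\<close> if \<open>a < 0\<close>, and its exponential does if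
    \<open>a = 0\<close>; for \<open>\<epsilon> \<le> 1\<close> the term \<open>G (R + 1)\<close> may be multiplied by \<open>\<epsilon> powr (1 - p) \<ge> 1\<close> as well\<close>
  define C where "C = (if a = 0 then ln (R + 1) + K
    else ((R + 1) powr (- a) + (- a) * K) powr (1 / (- a)))"
  have base: "(R + 1) powr (- a) + (- a) * K > 0"
    using assms(2,3) K by (intro add_pos_nonneg) (auto intro: mult_nonpos_nonneg)
  have "ln (R + 1) > 0" using assms(3) by (intro ln_gt_zero) simp
  then have C: "C > 0" using base K by (simp add: C_def del: ln_gt_zero_iff)
  have long: "T \<ge> R + 1 \<and> G T - G (R + 1) \<ge> K * \<epsilon> powr (1 - p)"
    if \<epsilon>: "0 < \<epsilon>" "\<epsilon> \<le> 1" and T: "?long C \<epsilon> T" for \<epsilon> T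
  proof -
    define E where "E = \<epsilon> powr (1 - p)"
    have E: "E \<ge> 1"
      using powr_mono2'[of "1 - p" \<epsilon> 1] \<epsilon> assms(1) by (simp add: E_def)
    show ?thesis
    proof (cases "a = 0")
      case True
      have R0: "ln (R + 1) \<ge> 0" using assms(3) by simp
      have "ln (R + 1) * 1 \<le> ln (R + 1) * E" by (intro mult_left_mono E R0)
      then have CE: "ln (R + 1) + K * E \<le> C * E"
        using True by (simp add: C_def algebra_simps)
      have TE: "exp (C * E) \<le> T" using T True by (simp add: E_def)
      then have "C * E \<le> ln T" using T by (simp add: ln_ge_iff)
      with CE have *: "ln (R + 1) + K * E \<le> ln T" by simp
      moreover have "0 \<le> K * E" using K E by simp
      ultimately have "ln (R + 1) \<le> ln T" by linarith
      then have "R + 1 \<le> T" using T assms(3) by simp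
      with * True show ?thesis by (simp add: G_def E_def)
    next
      case False
      define b where "b = - a"
      have b: "b > 0" using False assms(2) by (simp add: b_def)
      have Cb: "C powr b = (R + 1) powr b + b * K"
        using False base b by (simp add: C_def b_def powr_powr)
      have TE: "C * \<epsilon> powr ((1 - p) / b) \<le> T"
        using T False assms(2) by (simp add: b_def)
      have "(R + 1) powr b * 1 \<le> (R + 1) powr b * E" by (intro mult_left_mono E) auto
      then have "(R + 1) powr b + b * (K * E) \<le> C powr b * E"
        by (simp add: Cb algebra_simps)
      also have "\<dots> = (C * \<epsilon> powr ((1 - p) / b)) powr b"
        using C \<epsilon> b by (simp add: powr_mult powr_powr E_def)
      also have "\<dots> \<le> T powr b"
        using TE C b by (intro powr_mono2) auto
      finally have *: "(R + 1) powr b + b * (K * E) \<le> T powr b" .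
      moreover have "0 \<le> b * (K * E)" using b K E by simp
      ultimately have "(R + 1) powr b \<le> T powr b" by linarith
      then have "R + 1 \<le> T"
        using powr_less_mono2[of b T "R + 1"] b T by force
      moreover have "K * E \<le> T powr b / b - (R + 1) powr b / b"
        using * b by (simp add: field_simps)
      ultimately show ?thesis
        using False by (simp add: G_def E_def b_def)
    qed
  qed
  show "\<exists>C>0. \<forall>\<epsilon> T. 0 < \<epsilon> \<and> \<epsilon> \<le> 1 \<and> ?long C \<epsilon> T \<longrightarrow> \<not> ?sol f \<epsilon> T"
  proof (intro exI[of _ C] conjI allI impI notI C)
    fix \<epsilon> T assume *: "0 < \<epsilon> \<and> \<epsilon> \<le> 1 \<and> ?long C \<epsilon> T" and "?sol f \<epsilon> T"
    then obtain U where U: "continuous_on (UNIV \<times> {0..T}) U"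
      and eq: "\<forall>(x, t) \<in> UNIV \<times> {0..T}.
        U (x, t) = \<epsilon> * u0_t f g (x, t) + L' a (\<lambda>z. \<bar>U z\<bar> powr p) (x, t)"
      by (elim exE conjE)
    from * have \<epsilon>: "0 < \<epsilon>" and T: "T \<ge> R + 1"
      and "K * \<epsilon> powr (1 - p) \<le> G T - G (R + 1)"
      using long[of \<epsilon> T] by simp_all
    moreover have "G T - G (R + 1) < K * \<epsilon> powr (1 - p)"
      using bound[rule_format, OF \<epsilon> T U] eq by simp
    ultimately show False by linarith
  qed
qed simp

end
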